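(* Let $M$ be a matroid on a finite ground set $E$ and $<$ a linear order on $E$. Then the $h$-vector of the external activity complex $\mathrm{Act}_<(M)$ equals the $h$-vector of the independence complex $IN(M)$ (both $h$-vectors being regarded as sequences $(h_0,h_1,\dots)$ extended by zeros).
   Context: For a basis $B$ and $e\in E-B$, $\mathrm{Circ}(B,e)$ is the unique circuit in $B\cup e$; $EA(B)=\{e\in E-B: e=\min_<\mathrm{Circ}(B,e)\}$, $EP(B)=(E-B)-EA(B)$. With $\overline{E}$ a disjoint copy of $E$ and $\overline{S}$ the copy of $S\subseteq E$, $\mathrm{Act}_<(M)$ is the simplicial complex on $E\sqcup\overline{E}$ with facets $F(B)=B\cup EP(B)\cup\overline{B\cup EA(B)}$, $B$ a basis. $IN(M)$ is the complex of independent sets of $M$. For a $(d-1)$-dimensional complex with $f_i$ faces of size $i$, the $h$-vector is defined by $\sum_{i=0}^d f_i(x-1)^{d-i}=\sum_{i=0}^d h_ix^{d-i}$. *)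

theory Defs
  imports Complex_Main "HOL-Computational_Algebra.Polynomial"
begin

section \<open>Matroids\<close>

locale matroid =
  fixes E :: "'a set" and indep :: "'a set \<Rightarrow> bool"
  assumes finite_ground: "finite E"
    and indep_subset_ground: "indep X \<Longrightarrow> X \<subseteq> E"
    and indep_empty: "indep {}"
    and indep_subset: "indep X \<Longrightarrow> Y \<subseteq> X \<Longrightarrow> indep Y"
    and indep_augment: "indep X \<Longrightarrow> indep Y \<Longrightarrow> card X < card Y \<Longrightarrow> \<exists>y\<in>Y - X. indep (insert y X)"

definition basis :: "('a set \<Rightarrow> bool) \<Rightarrow> 'a set \<Rightarrow> bool" where
  "basis indep B \<longleftrightarrow> indep B \<and> (\<forall>X. indep X \<longrightarrow> B \<subseteq> X \<longrightarrow> X = B)"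

definition circuit :: "'a set \<Rightarrow> ('a set \<Rightarrow> bool) \<Rightarrow> 'a set \<Rightarrow> bool" where
  "circuit E indep C \<longleftrightarrow> C \<subseteq> E \<and> \<not> indep C \<and> (\<forall>X. X \<subset> C \<longrightarrow> indep X)"

text \<open>For a basis \<open>B\<close> and \<open>e \<in> E - B\<close> the description is proper, see \<open>ex1_fund_circuit\<close> below.\<close>

definition fund_circuit :: "'a set \<Rightarrow> ('a set \<Rightarrow> bool) \<Rightarrow> 'a set \<Rightarrow> 'a \<Rightarrow> 'a set" where
  "fund_circuit E indep B e = (THE C. circuit E indep C \<and> C \<subseteq> insert e B)"

lemma (in matroid) indep_extend:
  assumes "indep X" "indep Y" "card X \<le> card Y"
  shows "\<exists>Z. indep Z \<and> X \<subseteq> Z \<and> Z \<subseteq> X \<union> Y \<and> card Z = card Y"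
  using assms
proof (induction "card Y - card X" arbitrary: X)
  case 0
  then show ?case by (intro exI[of _ X]) auto
next
  case (Suc n)
  then obtain y where y: "y \<in> Y - X" "indep (insert y X)"
    using indep_augment[of X Y] by (metis diff_is_0_eq leI nat.distinct(1))
  have "finite X"
    by (rule finite_subset[OF indep_subset_ground[OF Suc.prems(1)] finite_ground])
  with y Suc.hyps(2) have "n = card Y - card (insert y X)" "card (insert y X) \<le> card Y"
    by auto
  from Suc.hyps(1)[OF this(1) y(2) Suc.prems(2) this(2)] show ?case
    using y(1) by blast
qed

lemma (in matroid) ex1_fund_circuit:
  assumes "basis indep B" "e \<in> E - B"
  shows "\<exists>!C. circuit E indep C \<and> C \<subseteq> insert e B"
proof -
  have B: "indep B" and dep: "\<not> indep (insert e B)"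
    using assms by (auto simp: basis_def)
  have sub: "insert e B \<subseteq> E"
    using assms(2) indep_subset_ground[OF B] by auto
  have fin: "finite (insert e B)"
    by (rule finite_subset[OF sub finite_ground])
  have "finite {C. C \<subseteq> insert e B \<and> \<not> indep C}" "insert e B \<in> {C. C \<subseteq> insert e B \<and> \<not> indep C}"
    using fin dep by simp_all
  from finite_has_minimal2[OF this] obtain C where
    C: "C \<subseteq> insert e B" "\<not> indep C" "\<And>D. D \<subseteq> insert e B \<Longrightarrow> \<not> indep D \<Longrightarrow> D \<subseteq> C \<Longrightarrow> C = D"
    by auto
  have "indep X" if "X \<subset> C" for X
    using C(3)[of X] C(1) that by auto
  hence "circuit E indep C"
    unfolding circuit_def using C(1,2) sub by auto
  have "D = {x \<in> insert e B. indep (insert e B - {x})}"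
    if D: "circuit E indep D" "D \<subseteq> insert e B" for D
  proof (intro equalityI subsetI)
    fix x assume x: "x \<in> D"
    have iD: "indep (D - {x})" and nD: "\<not> indep D"
      using D(1) x by (auto simp: circuit_def)
    have "card (D - {x}) \<le> card (insert e B) - 1"
      using x card_mono[OF fin D(2)] by (simp add: card_Diff_singleton)
    hence "card (D - {x}) \<le> card B"
      using assms(2) fin by simp
    from indep_extend[OF iD B this] obtain Z where
      Z: "indep Z" "D - {x} \<subseteq> Z" "Z \<subseteq> (D - {x}) \<union> B" "card Z = card B"
      by blast
    have "x \<notin> Z"
      using Z(1,2) nD indep_subset[of Z D] by blast
    moreover have "Z \<subseteq> insert e B"
      using Z(3) D(2) by blast
    ultimately have "Z \<subseteq> insert e B - {x}"
      by blast
    moreover have "card (insert e B - {x}) = card Z"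
      using subsetD[OF D(2) x] fin assms(2) Z(4) by (simp add: card_Diff_singleton)
    ultimately have "Z = insert e B - {x}"
      using fin by (intro card_subset_eq) auto
    with Z(1) subsetD[OF D(2) x] show "x \<in> {x \<in> insert e B. indep (insert e B - {x})}"
      by simp
  next
    fix x assume "x \<in> {x \<in> insert e B. indep (insert e B - {x})}"
    hence "indep (insert e B - {x})"
      by simp
    moreover have "\<not> indep D"
      using D(1) by (simp add: circuit_def)
    ultimately have "\<not> D \<subseteq> insert e B - {x}"
      using indep_subset by blast
    with D(2) show "x \<in> D"
      by blast
  qed
  note uniq = this
  show ?thesis
  proof (rule ex1I[of _ C])
    show "circuit E indep C \<and> C \<subseteq> insert e B"
      using \<open>circuit E indep C\<close> C(1) by simp
    show "D = C" if "circuit E indep D \<and> D \<subseteq> insert e B" for D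
      using uniq[of D] uniq[of C] that \<open>circuit E indep C\<close> C(1) by simp
  qed
qed


section \<open>External activity\<close>

text \<open>The linear order is given by its reflexive relation \<open>r\<close>: \<open>(x, y) \<in> r\<close> means \<open>x \<le> y\<close>.\<close>

definition ext_active :: "'a set \<Rightarrow> ('a set \<Rightarrow> bool) \<Rightarrow> 'a rel \<Rightarrow> 'a set \<Rightarrow> 'a set" where
  "ext_active E indep r B =
     {e \<in> E - B. e \<in> fund_circuit E indep B e \<and> (\<forall>x\<in>fund_circuit E indep B e. (e, x) \<in> r)}"

definition ext_passive :: "'a set \<Rightarrow> ('a set \<Rightarrow> bool) \<Rightarrow> 'a rel \<Rightarrow> 'a set \<Rightarrow> 'a set" where
  "ext_passive E indep r B = (E - B) - ext_active E indep r B"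


section \<open>Simplicial complexes\<close>

text \<open>A simplicial complex is represented by the set of all its faces, including the empty one.
  The disjoint union of \<open>E\<close> with its copy lives in the sum type: \<open>Inl e\<close> is the element \<open>e\<close>
  itself and \<open>Inr e\<close> its copy.\<close>

definition independence_complex :: "('a set \<Rightarrow> bool) \<Rightarrow> 'a set set" where
  "independence_complex indep = {S. indep S}"

definition act_facet :: "'a set \<Rightarrow> ('a set \<Rightarrow> bool) \<Rightarrow> 'a rel \<Rightarrow> 'a set \<Rightarrow> ('a + 'a) set" where
  "act_facet E indep r B =
     Inl ` (B \<union> ext_passive E indep r B) \<union> Inr ` (B \<union> ext_active E indep r B)"

definition ext_activity_complex :: "'a set \<Rightarrow> ('a set \<Rightarrow> bool) \<Rightarrow> 'a rel \<Rightarrow> ('a + 'a) set set" where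
  "ext_activity_complex E indep r = {S. \<exists>B. basis indep B \<and> S \<subseteq> act_facet E indep r B}"

definition f_vector :: "'v set set \<Rightarrow> nat \<Rightarrow> nat" where
  "f_vector K i = card {S \<in> K. card S = i}"

text \<open>The maximal size \<open>d\<close> of a face, so that \<open>K\<close> is \<open>(d - 1)\<close>-dimensional.\<close>

definition max_face_size :: "'v set set \<Rightarrow> nat" where
  "max_face_size K = Max (card ` K)"

definition f_poly :: "'v set set \<Rightarrow> int poly" where
  "f_poly K = (\<Sum>i\<le>max_face_size K. of_nat (f_vector K i) * [:-1, 1:] ^ (max_face_size K - i))"

definition h_vector :: "'v set set \<Rightarrow> nat \<Rightarrow> int" where
  "h_vector K i = (if i \<le> max_face_size K then coeff (f_poly K) (max_face_size K - i) else 0)"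

text \<open>The identity by which the \<open>h\<close>-vector is defined; it determines \<open>h\<^sub>0, \<dots>, h\<^sub>d\<close>.\<close>

lemma h_vector_identity:
  fixes K :: "'v set set"
  defines "d \<equiv> max_face_size K"
  shows "(\<Sum>i\<le>d. of_nat (f_vector K i) * [:-1, 1:] ^ (d - i)) = (\<Sum>i\<le>d. monom (h_vector K i) (d - i))"
proof -
  have "degree (of_nat (f_vector K i) * [:-1, 1 :: int:] ^ (d - i)) \<le> d" for i
    using degree_mult_le[of "of_nat (f_vector K i)" "[:-1, 1 :: int:] ^ (d - i)"]
    by (simp add: degree_power_eq)
  hence deg: "degree (f_poly K) \<le> d"
    unfolding f_poly_def d_def[symmetric] by (intro degree_sum_le) auto
  have "f_poly K = (\<Sum>i\<le>d. monom (coeff (f_poly K) i) i)"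
    by (rule poly_as_sum_of_monoms'[OF deg, symmetric])
  also have "\<dots> = (\<Sum>i\<le>d. monom (coeff (f_poly K) (d - i)) (d - i))"
    by (rule sum.reindex_bij_witness[of _ "\<lambda>i. d - i" "\<lambda>i. d - i"]) auto
  also have "\<dots> = (\<Sum>i\<le>d. monom (h_vector K i) (d - i))"
    by (intro sum.cong) (auto simp: h_vector_def d_def)
  finally show ?thesis
    by (simp add: f_poly_def d_def)
qed

end

theory Submission
  imports Defs
begin

text \<open>Induction on the ground set by deletion and contraction of its greatest element \<open>e\<close>. Being
  greatest, \<open>e\<close> is externally active only if it is a loop, and it does not affect the activity of
  other elements. If \<open>e\<close> is neither a loop nor a coloop, the activity complex is therefore the cone
  with apex \<open>e\<close> over the union of the complex of the deletion and the cone with apex the copy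
  of \<open>e\<close> over the complex of the contraction. The latter complex is
  contained in the former, so this is the recursion of the independence complex up to the factor
  \<open>x\<close> contributed by the outer cone. A loop contributes one cone and a coloop
  two, which again gives one factor \<open>x\<close> more than for the independence complex. Hence the face
  polynomials differ by the factor \<open>x\<^sup>n\<close>, where \<open>n\<close> is the size of the ground set.\<close>

section \<open>Face polynomials\<close>

text \<open>The degree \<open>d\<close> is a parameter so that complexes of different dimensions can
  be added in one recursion. As subtraction truncates, \<open>d\<close> has to bound the face
  sizes.\<close>

definition face_poly :: "'v set set \<Rightarrow> nat \<Rightarrow> int poly" where
  "face_poly K d = (\<Sum>S\<in>K. [:-1, 1:] ^ (d - card S))"

definition cone :: "'v \<Rightarrow> 'v set set \<Rightarrow> 'v set set" where
  "cone v K = K \<union> insert v ` K"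

lemma f_poly_eq_face_poly:
  assumes "finite K"
  shows "f_poly K = face_poly K (max_face_size K)"
proof -
  let ?d = "max_face_size K"
  have le: "card S \<le> ?d" if "S \<in> K" for S
    unfolding max_face_size_def using assms that by (intro Max_ge) auto
  have "face_poly K ?d = (\<Sum>i\<le>?d. \<Sum>S\<in>{S\<in>K. card S = i}. [:-1, 1:] ^ (?d - card S))"
    unfolding face_poly_def by (rule sum.group[symmetric]) (use assms le in auto)
  also have "\<dots> = f_poly K"
    unfolding f_poly_def f_vector_def by (intro sum.cong) auto
  finally show ?thesis ..
qed

text \<open>A new vertex raises face size and degree together, so the exponents for \<open>L\<close>
  do not change; freshness of \<open>v\<close> makes the two families disjoint and the insertion
  injective.\<close>

lemma face_poly_Un_insert:
  assumes "finite K" "finite L" "\<And>S. S \<in> L \<Longrightarrow> finite S"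
    and "\<And>S. S \<in> K \<union> L \<Longrightarrow> v \<notin> S"
  shows "face_poly (K \<union> insert v ` L) (Suc d) = face_poly K (Suc d) + face_poly L d"
proof -
  have "inj_on (insert v) L"
    using assms(4) by (intro inj_onI) (metis UnI2 insert_ident)
  hence "face_poly (insert v ` L) (Suc d) = face_poly L d"
    unfolding face_poly_def using assms(3,4) by (subst sum.reindex) (auto intro!: sum.cong)
  moreover have "K \<inter> insert v ` L = {}"
    using assms(4) by auto
  ultimately show ?thesis
    using assms(1,2) by (simp add: face_poly_def sum.union_disjoint)
qed

lemma face_poly_Suc:
  assumes "\<And>S. S \<in> K \<Longrightarrow> card S \<le> d"
  shows "face_poly K (Suc d) = [:-1, 1:] * face_poly K d"
  unfolding face_poly_def sum_distrib_left
  using assms by (intro sum.cong) (auto simp: Suc_diff_le simp del: mult_pCons_left)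

text \<open>Faces without the apex contribute the factor \<open>[:-1, 1:]\<close>, faces with it the
  factor 1, and these add up to \<open>[:0, 1:]\<close>.\<close>

lemma face_poly_cone:
  assumes "finite K" "\<And>S. S \<in> K \<Longrightarrow> finite S \<and> card S \<le> d \<and> v \<notin> S"
  shows "face_poly (cone v K) (Suc d) = [:0, 1:] * face_poly K d"
proof -
  have "face_poly (cone v K) (Suc d) = face_poly K (Suc d) + face_poly K d"
    unfolding cone_def using assms by (intro face_poly_Un_insert) auto
  also have "\<dots> = ([:-1, 1:] + 1) * face_poly K d"
    using assms(2) by (subst face_poly_Suc) (auto simp: algebra_simps simp del: mult_pCons_left mult_pCons_right)
  also have "[:-1, 1:] + 1 = [:0, 1 :: int:]"
    by (simp add: one_pCons)
  finally show ?thesis .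
qed

lemma UN_Pow_insert: "(\<Union>B\<in>\<B>. Pow (insert v (g B))) = cone v (\<Union>B\<in>\<B>. Pow (g B))"
  by (auto simp: cone_def Pow_insert)


section \<open>Linear orders on finite sets\<close>

text \<open>Also applied to the converse of an order, to obtain greatest elements.\<close>

lemma linear_order_on_has_least:
  assumes "linear_order_on A r" "finite X" "X \<noteq> {}" "X \<subseteq> A"
  shows "\<exists>m\<in>X. \<forall>x\<in>X. (m, x) \<in> r"
  using assms(2-)
proof (induction rule: finite_ne_induct)
  case (singleton x)
  then show ?case
    using assms(1) by (auto simp: order_on_defs refl_on_def)
next
  case (insert y X)
  then obtain m where m: "m \<in> X" "\<forall>x\<in>X. (m, x) \<in> r"
    by auto
  have yy: "(y, y) \<in> r" and ym: "(m, y) \<in> r \<or> (y, m) \<in> r" and r: "trans r"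
    using assms(1) insert m(1) by (auto simp: order_on_defs refl_on_def total_on_def)
  have "\<forall>x\<in>X. (y, x) \<in> r" if "(y, m) \<in> r"
    using m(2) transD[OF r that] by blast
  with ym m yy show ?case
    by (elim disjE) auto
qed


section \<open>Minors and activity\<close>

definition deletion :: "('a set \<Rightarrow> bool) \<Rightarrow> 'a \<Rightarrow> 'a set \<Rightarrow> bool" where
  "deletion indep e X \<longleftrightarrow> e \<notin> X \<and> indep X"

text \<open>This is the matroid contraction only if \<open>e\<close> is not a loop; for a loop no
  set satisfies it.\<close>

definition contraction :: "('a set \<Rightarrow> bool) \<Rightarrow> 'a \<Rightarrow> 'a set \<Rightarrow> bool" where
  "contraction indep e X \<longleftrightarrow> e \<notin> X \<and> indep (insert e X)"

context matroid
begin

section \<open>Bases and rank\<close>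

lemma indep_finite: "indep X \<Longrightarrow> finite X"
  using indep_subset_ground finite_ground finite_subset by blast

lemma finite_indep: "finite {X. indep X}"
  by (rule finite_subset[of _ "Pow E"]) (use indep_subset_ground finite_ground in auto)

lemma indep_card_le_basis:
  assumes "basis indep B" "indep X"
  shows "card X \<le> card B"
proof (rule ccontr)
  assume "\<not> card X \<le> card B"
  then obtain y where "y \<in> X - B" "indep (insert y B)"
    using assms indep_augment[of B X] by (auto simp: basis_def)
  thus False
    using assms(1) by (auto simp: basis_def)
qed

lemma basis_iff_card:
  assumes "basis indep B"
  shows "basis indep X \<longleftrightarrow> indep X \<and> card X = card B"
proof
  assume "basis indep X"
  thus "indep X \<and> card X = card B"
    using assms indep_card_le_basis by (simp add: basis_def le_antisym)
next
  assume X: "indep X \<and> card X = card B"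
  have "Y = X" if "indep Y" "X \<subseteq> Y" for Y
    using that X indep_card_le_basis[OF assms that(1)] indep_finite[OF that(1)]
    by (metis card_seteq)
  thus "basis indep X"
    using X by (simp add: basis_def)
qed

lemma indep_subset_basis:
  assumes "indep X"
  shows "\<exists>B. basis indep B \<and> X \<subseteq> B"
proof -
  have "finite {Y. indep Y \<and> X \<subseteq> Y}"
    by (rule finite_subset[OF _ finite_indep]) auto
  from finite_has_maximal2[OF this, of X] assms obtain B where
    "indep B" "X \<subseteq> B" "\<And>Y. indep Y \<Longrightarrow> X \<subseteq> Y \<Longrightarrow> B \<subseteq> Y \<Longrightarrow> B = Y"
    by auto
  thus ?thesis
    unfolding basis_def by (intro exI[of _ B]) auto
qed

section \<open>Bases of deletion and contraction\<close>

lemma matroid_deletion: "matroid (E - {e}) (deletion indep e)"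
proof
  show "\<exists>y\<in>Y - X. deletion indep e (insert y X)"
    if "deletion indep e X" "deletion indep e Y" "card X < card Y" for X Y
    using that indep_augment[of X Y] by (auto simp: deletion_def)
  show "deletion indep e Y" if "deletion indep e X" "Y \<subseteq> X" for X Y
    using that indep_subset[of X Y] by (auto simp: deletion_def)
  show "X \<subseteq> E - {e}" if "deletion indep e X" for X
    using that indep_subset_ground[of X] by (auto simp: deletion_def)
qed (use finite_ground indep_empty in \<open>simp_all add: deletion_def\<close>)

lemma matroid_contraction:
  assumes "indep {e}"
  shows "matroid (E - {e}) (contraction indep e)"
proof
  show "\<exists>y\<in>Y - X. contraction indep e (insert y X)"
    if "contraction indep e X" "contraction indep e Y" "card X < card Y" for X Y
  proof -
    have "finite X" "finite Y"
      using that(1,2) indep_finite[of "insert e _"] by (simp_all add: contraction_def)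
    hence "card (insert e X) < card (insert e Y)"
      using that by (simp add: contraction_def)
    thus ?thesis
      using that indep_augment[of "insert e X" "insert e Y"]
      by (auto simp: contraction_def insert_commute)
  qed
  show "contraction indep e Y" if "contraction indep e X" "Y \<subseteq> X" for X Y
    using that indep_subset[of "insert e X" "insert e Y"] by (auto simp: contraction_def)
  show "X \<subseteq> E - {e}" if "contraction indep e X" for X
    using that indep_subset_ground[of "insert e X"] by (auto simp: contraction_def)
qed (use assms finite_ground in \<open>simp_all add: contraction_def\<close>)

text \<open>The basis \<open>B0\<close> shows that \<open>e\<close> is not a coloop. Hence deletion
  keeps the rank, and on both sides bases are the independent sets of size
  \<open>card B0\<close>.\<close>

lemma basis_deletion_iff:
  assumes "basis indep B0" "e \<notin> B0"
  shows "basis (deletion indep e) B \<longleftrightarrow> basis indep B \<and> e \<notin> B"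
proof -
  interpret D: matroid "E - {e}" "deletion indep e"
    by (rule matroid_deletion)
  have "basis (deletion indep e) B0"
    using assms by (auto simp: basis_def deletion_def)
  thus ?thesis
    using D.basis_iff_card basis_iff_card[OF assms(1)] by (auto simp: deletion_def)
qed

lemma basis_contraction_iff:
  assumes "indep {e}"
  shows "basis (contraction indep e) B \<longleftrightarrow> e \<notin> B \<and> basis indep (insert e B)"
proof (intro iffI conjI)
  assume B: "basis (contraction indep e) B"
  thus e: "e \<notin> B"
    by (simp add: basis_def contraction_def)
  have "X = insert e B" if "indep X" "insert e B \<subseteq> X" for X
  proof -
    have "contraction indep e (X - {e})" "B \<subseteq> X - {e}"
      using e that by (auto simp: contraction_def insert_absorb)
    hence "X - {e} = B"
      using B by (simp add: basis_def)
    thus ?thesis using that by auto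
  qed
  thus "basis indep (insert e B)"
    using B by (auto simp: basis_def contraction_def)
next
  assume B: "e \<notin> B \<and> basis indep (insert e B)"
  have "X = B" if "e \<notin> X" "indep (insert e X)" "B \<subseteq> X" for X
  proof -
    have "insert e X = insert e B"
      using B that by (auto simp: basis_def)
    thus ?thesis using B that by (simp add: insert_ident)
  qed
  thus "basis (contraction indep e) B"
    using B by (auto simp: basis_def contraction_def)
qed

section \<open>Activity as a condition on basis exchange\<close>

lemma dependent_contains_circuit:
  assumes "X \<subseteq> E" "\<not> indep X"
  shows "\<exists>C\<subseteq>X. circuit E indep C"
proof -
  have "finite {C. C \<subseteq> X \<and> \<not> indep C}"
    using finite_subset[OF assms(1) finite_ground] by simp
  from finite_has_minimal2[OF this, of X] assms obtain C where
    "C \<subseteq> X" "\<not> indep C" "\<And>D. D \<subseteq> X \<Longrightarrow> \<not> indep D \<Longrightarrow> D \<subseteq> C \<Longrightarrow> C = D"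
    by auto
  thus ?thesis
    using assms(1) unfolding circuit_def by (intro exI[of _ C]) blast
qed

text \<open>Removing an element of the unique circuit in \<open>insert e B\<close> destroys the only
  circuit; removing any other element leaves it intact.\<close>

lemma fund_circuit_eq:
  assumes "basis indep B" "e \<in> E - B"
  shows "fund_circuit E indep B e = {x \<in> insert e B. indep (insert e B - {x})}"
proof -
  let ?C = "fund_circuit E indep B e"
  note ex1 = ex1_fund_circuit[OF assms]
  have C: "circuit E indep ?C" "?C \<subseteq> insert e B"
    using theI'[OF ex1] by (auto simp: fund_circuit_def)
  have BE: "insert e B \<subseteq> E"
    using assms indep_subset_ground by (auto simp: basis_def)
  have "x \<in> ?C \<longleftrightarrow> indep (insert e B - {x})" if "x \<in> insert e B" for x
  proof
    assume x: "x \<in> ?C"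
    show "indep (insert e B - {x})"
    proof (rule ccontr)
      assume "\<not> indep (insert e B - {x})"
      then obtain D where "D \<subseteq> insert e B - {x}" "circuit E indep D"
        using dependent_contains_circuit[of "insert e B - {x}"] BE by blast
      with ex1 C x show False by blast
    qed
  next
    assume "indep (insert e B - {x})"
    moreover have "\<not> indep ?C"
      using C(1) by (simp add: circuit_def)
    ultimately have "\<not> ?C \<subseteq> insert e B - {x}"
      using indep_subset by blast
    with C(2) show "x \<in> ?C"
      by blast
  qed
  with C(2) show ?thesis by blast
qed

text \<open>In terms of exchanges, activity transfers easily to minors. The order lives on a set
  \<open>A\<close> around \<open>E\<close>, so it stays fixed while the ground set shrinks.\<close>

lemma ext_active_iff:
  assumes "basis indep B" "linear_order_on A r" "E \<subseteq> A"
  shows "e \<in> ext_active E indep r B \<longleftrightarrow>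
    e \<in> E - B \<and> (\<forall>x\<in>B. indep (insert e (B - {x})) \<longrightarrow> (e, x) \<in> r)"
proof (cases "e \<in> E - B")
  case True
  have "insert e B - {x} = insert e (B - {x})" if "x \<in> B" for x
    using True that by auto
  moreover have "insert e B - {e} = B" "(e, e) \<in> r" "indep B"
    using True assms by (auto simp: order_on_defs refl_on_def basis_def)
  ultimately show ?thesis
    using True by (auto simp: ext_active_def fund_circuit_eq[OF assms(1) True])
qed (auto simp: ext_active_def)

section \<open>Facets and dimension\<close>

lemma act_facet_subset:
  assumes "indep B"
  shows "act_facet E indep r B \<subseteq> Inl ` E \<union> Inr ` E"
proof -
  have "B \<union> ext_passive E indep r B \<subseteq> E" "B \<union> ext_active E indep r B \<subseteq> E"
    using indep_subset_ground[OF assms] by (auto simp: ext_active_def ext_passive_def)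
  thus ?thesis
    unfolding act_facet_def by (intro Un_mono image_mono)
qed

lemma finite_ext_activity_complex: "finite (ext_activity_complex E indep r)"
proof -
  have "ext_activity_complex E indep r \<subseteq> Pow (Inl ` E \<union> Inr ` E)"
    using act_facet_subset by (fastforce simp: ext_activity_complex_def basis_def)
  thus ?thesis
    using finite_ground by (auto intro: finite_subset)
qed

text \<open>Elements of \<open>B\<close> occur with both copies, every other element of
  \<open>E\<close> with exactly one.\<close>

lemma card_act_facet:
  assumes "basis indep B"
  shows "finite (act_facet E indep r B) \<and> card (act_facet E indep r B) = card E + card B"
proof -
  have fin: "finite B" "B \<subseteq> E"
    using assms indep_finite indep_subset_ground by (auto simp: basis_def)
  let ?A = "ext_active E indep r B" and ?P = "ext_passive E indep r B"
  have A: "?A \<subseteq> E - B"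
    by (auto simp: ext_active_def)
  have P: "?P = E - B - ?A"
    by (simp add: ext_passive_def)
  have finAP: "finite ?A" "finite ?P"
    using A P finite_ground by (auto intro: finite_subset)
  have "card E = card (B \<union> ?P \<union> ?A)"
    using A P fin(2) by (intro arg_cong[of _ _ card]) auto
  also have "\<dots> = card (B \<union> ?P) + card ?A"
    using A P fin finAP by (intro card_Un_disjoint) auto
  finally have "card (B \<union> ?P) + card ?A = card E" ..
  moreover have "card (B \<union> ?A) = card B + card ?A"
    using A fin finAP by (intro card_Un_disjoint) auto
  moreover have "card (act_facet E indep r B) = card (B \<union> ?P) + card (B \<union> ?A)"
    unfolding act_facet_def using fin finAP
    by (subst card_Un_disjoint) (auto simp: card_image)
  ultimately show ?thesis
    using fin finAP by (simp add: act_facet_def)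
qed

lemma ext_activity_complex_face:
  assumes "basis indep B" "S \<in> ext_activity_complex E indep r"
  shows "finite S" "card S \<le> card E + card B" "S \<subseteq> Inl ` E \<union> Inr ` E"
proof -
  obtain B' where B': "basis indep B'" "S \<subseteq> act_facet E indep r B'"
    using assms(2) by (auto simp: ext_activity_complex_def)
  hence "card B' = card B"
    using assms(1) basis_iff_card by blast
  with B' card_act_facet[OF B'(1), of r] show "finite S" "card S \<le> card E + card B"
    by (metis finite_subset, metis card_mono)
  show "S \<subseteq> Inl ` E \<union> Inr ` E"
    using B' act_facet_subset[of B' r] by (auto simp: basis_def)
qed

lemma max_face_size_ext_activity_complex:
  assumes "basis indep B"
  shows "max_face_size (ext_activity_complex E indep r) = card E + card B"
proof -
  have "act_facet E indep r B \<in> ext_activity_complex E indep r"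
    using assms by (auto simp: ext_activity_complex_def)
  hence "card E + card B \<in> card ` ext_activity_complex E indep r"
    using card_act_facet[OF assms, of r] by (metis imageI)
  thus ?thesis
    unfolding max_face_size_def
    using finite_ext_activity_complex ext_activity_complex_face(2)[OF assms]
    by (intro Max_eqI) auto
qed

lemma max_face_size_independence_complex:
  assumes "basis indep B"
  shows "max_face_size (independence_complex indep) = card B"
  unfolding max_face_size_def independence_complex_def
  using finite_indep indep_card_le_basis[OF assms] assms
  by (intro Max_eqI) (auto simp: basis_def)

text \<open>With passivity eliminated, facets of minors are compared through their active
  sets.\<close>

lemma act_facet_eq:
  assumes "basis indep B"
  shows "act_facet E indep r B =
    Inl ` (E - ext_active E indep r B) \<union> Inr ` (B \<union> ext_active E indep r B)"
proof -
  have "B \<union> ext_passive E indep r B = E - ext_active E indep r B"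
    using assms indep_subset_ground[of B]
    by (auto simp: basis_def ext_passive_def ext_active_def)
  thus ?thesis
    by (simp add: act_facet_def)
qed

section \<open>Activity in minors\<close>

lemma ext_active_deletion:
  assumes "basis indep B" "e \<in> E - B" "linear_order_on A r" "E \<subseteq> A"
  shows "ext_active (E - {e}) (deletion indep e) r B = ext_active E indep r B - {e}"
proof -
  interpret D: matroid "E - {e}" "deletion indep e"
    by (rule matroid_deletion)
  have B: "basis (deletion indep e) B" and A: "E - {e} \<subseteq> A"
    using assms basis_deletion_iff[of B] by auto
  show ?thesis
    using assms(2) D.ext_active_iff[OF B assms(3) A] ext_active_iff[OF assms(1,3,4)]
    by (auto simp: deletion_def)
qed

text \<open>A non-loop outside \<open>B\<close> can replace some element of \<open>B\<close>, which
  is smaller and lies in its circuit. A loop takes part in no exchange, so it is active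
  vacuously.\<close>

lemma ext_active_greatest:
  assumes "basis indep B" "e \<in> E - B" "linear_order_on A r" "E \<subseteq> A"
    and "\<And>x. x \<in> E \<Longrightarrow> (x, e) \<in> r"
  shows "e \<in> ext_active E indep r B \<longleftrightarrow> \<not> indep {e}"
proof
  assume "\<not> indep {e}"
  hence "\<not> indep (insert e X)" for X
    using indep_subset[of "insert e X" "{e}"] by auto
  thus "e \<in> ext_active E indep r B"
    using assms(2) ext_active_iff[OF assms(1,3,4)] by simp
next
  assume active: "e \<in> ext_active E indep r B"
  show "\<not> indep {e}"
  proof
    assume e: "indep {e}"
    have B: "indep B" "finite B" "B \<subseteq> E"
      using assms(1) indep_finite indep_subset_ground by (auto simp: basis_def)
    \<comment> \<open>Completing \<open>{e}\<close> by elements of \<open>B\<close> to the size of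
      \<open>B\<close> leaves out one element of \<open>B\<close>; this is the \<open>x\<close> that
      \<open>e\<close> can replace.\<close>
    obtain Z where Z: "indep Z" "{e} \<subseteq> Z" "Z \<subseteq> {e} \<union> B" "card Z = card B"
      using indep_extend[OF e B(1)] indep_card_le_basis[OF assms(1) e] by auto
    have "\<not> B \<subseteq> Z"
    proof
      assume "B \<subseteq> Z"
      hence "B = Z"
        using Z indep_finite by (metis card_subset_eq)
      thus False
        using Z(2) assms(2) by auto
    qed
    then obtain x where x: "x \<in> B" "x \<notin> Z"
      by auto
    have "card (insert e (B - {x})) = card Z"
      using x B assms(2) Z(4) by (simp add: card_Suc_Diff1 del: card_Diff_insert)
    moreover have "Z \<subseteq> insert e (B - {x})"
      using Z(3) x by auto
    ultimately have "Z = insert e (B - {x})"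
      using B(2) by (intro card_subset_eq) auto
    hence "(e, x) \<in> r"
      using Z(1) x(1) active ext_active_iff[OF assms(1,3,4)] by auto
    moreover have "(x, e) \<in> r"
      using assms(5) x(1) B(3) by auto
    ultimately have "x = e"
      using assms(3) by (auto simp: order_on_defs antisym_def)
    thus False
      using x(1) assms(2) by auto
  qed
qed

lemma ext_active_contraction_iff:
  assumes "basis indep (insert e B)" "e \<notin> B" "linear_order_on A r" "E \<subseteq> A"
  shows "g \<in> ext_active (E - {e}) (contraction indep e) r B \<longleftrightarrow>
    g \<in> E - insert e B \<and> (\<forall>x\<in>B. indep (insert e (insert g (B - {x}))) \<longrightarrow> (g, x) \<in> r)"
proof -
  have e: "indep {e}"
    using assms(1) indep_subset[of "insert e B" "{e}"] by (simp add: basis_def)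
  interpret C: matroid "E - {e}" "contraction indep e"
    by (rule matroid_contraction[OF e])
  have B: "basis (contraction indep e) B" and A: "E - {e} \<subseteq> A"
    using assms basis_contraction_iff[OF e] by auto
  show ?thesis
    using assms(2) C.ext_active_iff[OF B assms(3) A] by (auto simp: contraction_def)
qed

text \<open>The basis \<open>insert e B\<close> offers one exchange more than the contraction, the
  one with \<open>e\<close>. It only demands \<open>(g, e) \<in> r\<close>, which holds as
  \<open>e\<close> is greatest.\<close>

lemma ext_active_contraction:
  assumes "basis indep (insert e B)" "e \<notin> B" "linear_order_on A r" "E \<subseteq> A"
    and "\<And>x. x \<in> E \<Longrightarrow> (x, e) \<in> r"
  shows "ext_active (E - {e}) (contraction indep e) r B = ext_active E indep r (insert e B)"
proof -
  have "insert g (insert e B - {x}) = insert e (insert g (B - {x}))" if "x \<in> B" for g x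
    using that assms(2) by auto
  thus ?thesis
    using ext_active_iff[OF assms(1,3,4)] ext_active_contraction_iff[OF assms(1-4)] assms(5)
    by auto
qed

text \<open>Augments \<open>insert b X\<close> from a larger set. With \<open>X = B - {x}\<close> it
  compares exchanges in the contraction with those in the deletion.\<close>

lemma indep_exchange_pair:
  assumes "indep (insert a (insert c X))" "a \<notin> X" "c \<notin> X" "a \<noteq> c" "indep (insert b X)"
  shows "indep (insert a (insert b X)) \<or> indep (insert c (insert b X))"
proof -
  have "finite X"
    using indep_finite[OF assms(5)] by simp
  hence "card (insert b X) < card (insert a (insert c X))"
    using assms(2-4) by (simp add: card_insert_if)
  from indep_augment[OF assms(5,1) this] show ?thesis
    by auto
qed

text \<open>Among the elements that complete \<open>B\<close> to a basis, choose \<open>f\<close> so that the least element of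
  its fundamental circuit in the contraction is as large as possible, and then \<open>f\<close> itself as
  small as possible: replacing \<open>e\<close> by \<open>f\<close> changes the activity of no other element.\<close>

lemma ext_active_contraction_deletion:
  assumes "basis indep (insert e B)" "e \<notin> B" "linear_order_on A r" "E \<subseteq> A"
    and "basis indep B0" "e \<notin> B0"
  shows "\<exists>f\<in>E - insert e B. basis indep (insert f B) \<and>
    ext_active (E - {e}) (deletion indep e) r (insert f B) =
    ext_active (E - {e}) (contraction indep e) r B - {f}"
proof -
  have eB: "indep (insert e B)" and B: "indep B" "finite B" "B \<subseteq> E" "e \<in> E"
    using assms(1) indep_subset[of "insert e B" B] indep_finite[of "insert e B"]
      indep_subset_ground[of "insert e B"] by (auto simp: basis_def)
  have r: "trans r" "antisym r" "(x, x) \<in> r" if "x \<in> E" for x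
    using assms(3,4) that by (auto simp: order_on_defs refl_on_def)
  \<comment> \<open>\<open>D\<close> holds the candidates for \<open>f\<close>. \<open>P h x\<close>
    says that \<open>h\<close> can replace \<open>x\<close> in the contraction, so
    \<open>N h\<close> is the fundamental circuit of \<open>h\<close> there; \<open>m h\<close>
    below is its least element.\<close>
  define D where "D = {g \<in> E - insert e B. indep (insert g B)}"
  define P where "P h x \<longleftrightarrow> indep (insert e (insert h (B - {x})))" for h x
  define N where "N h = insert h {x \<in> B. P h x}" for h
  have DE: "D \<subseteq> E" and finD: "finite D"
    using finite_ground by (auto simp: D_def)
  \<comment> \<open>There is a candidate: \<open>B\<close> is smaller than \<open>B0\<close>, and
    \<open>B0\<close> avoids \<open>e\<close>.\<close>
  have "card B < card B0"
    using assms(1,2,5) B(2) basis_iff_card[OF assms(5), of "insert e B"] by simp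
  then obtain y where "y \<in> B0 - B" "indep (insert y B)"
    using indep_augment[OF B(1)] assms(5) by (auto simp: basis_def)
  hence "y \<in> D"
    using assms(6) indep_subset_ground by (auto simp: D_def)
  have "\<exists>m\<in>N h. \<forall>x\<in>N h. (m, x) \<in> r" if "h \<in> D" for h
    using that B DE assms(4) by (intro linear_order_on_has_least[OF assms(3)]) (auto simp: N_def)
  then obtain m where m: "\<And>h. h \<in> D \<Longrightarrow> m h \<in> N h" "\<And>h x. h \<in> D \<Longrightarrow> x \<in> N h \<Longrightarrow> (m h, x) \<in> r"
    by metis
  have mE: "m h \<in> E" if "h \<in> D" for h
    using m(1)[OF that] that B(3) DE by (auto simp: N_def)
  have "\<exists>z\<in>m ` D. \<forall>x\<in>m ` D. (z, x) \<in> r\<inverse>"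
    using \<open>y \<in> D\<close> finD mE assms(3,4)
    by (intro linear_order_on_has_least[of A]) auto
  then obtain h0 where h0: "h0 \<in> D" "\<And>h. h \<in> D \<Longrightarrow> (m h, m h0) \<in> r"
    by auto
  have "\<exists>f\<in>{h\<in>D. m h = m h0}. \<forall>h\<in>{h\<in>D. m h = m h0}. (f, h) \<in> r"
    using h0(1) finD DE assms(4) by (intro linear_order_on_has_least[OF assms(3)]) auto
  then obtain f where f: "f \<in> D" and f_max: "\<And>h. h \<in> D \<Longrightarrow> (m h, m f) \<in> r"
    and f_min: "\<And>h. h \<in> D \<Longrightarrow> m h = m f \<Longrightarrow> (f, h) \<in> r"
    using h0(2) by auto
  have fE: "f \<in> E" "f \<noteq> e" "f \<notin> B" and fB: "indep (insert f B)"
    using f by (auto simp: D_def)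
  have "card (insert f B) = card (insert e B)"
    using fE assms(2) B(2) by simp
  hence basis: "basis indep (insert f B)"
    using fB basis_iff_card[OF assms(1)] by simp
  have sub: "indep (insert e (B - {x}))" "indep (insert f (B - {x}))" for x
    using indep_subset[OF eB] indep_subset[OF fB] by (meson Diff_subset insert_mono)+
  interpret del: matroid "E - {e}" "deletion indep e"
    by (rule matroid_deletion)
  have del_basis: "basis (deletion indep e) (insert f B)" and A: "E - {e} \<subseteq> A"
    using basis fE assms(2,4) basis_deletion_iff[OF basis] by auto
  \<comment> \<open>\<open>Q g x\<close> is the exchange of \<open>g\<close> with an element
    \<open>x\<close> of \<open>B\<close> in the basis \<open>insert f B\<close>. The exchange with
    \<open>f\<close> itself leaves \<open>insert g B\<close> and is treated separately.\<close>
  define Q where "Q g x \<longleftrightarrow> indep (insert g (insert f (B - {x})))" for g x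
  have active_del: "g \<in> ext_active (E - {e}) (deletion indep e) r (insert f B) \<longleftrightarrow>
      (indep (insert g B) \<longrightarrow> (g, f) \<in> r) \<and> (\<forall>x\<in>B. Q g x \<longrightarrow> (g, x) \<in> r)"
    if "g \<in> E - insert e B" "g \<noteq> f" for g
  proof -
    have "insert f B - {x} = insert f (B - {x})" if "x \<in> B" for x
      using that fE by auto
    moreover have "insert f B - {f} = B"
      using fE by auto
    ultimately show ?thesis
      using that fE assms(2) del.ext_active_iff[OF del_basis assms(3) A, of g]
      by (auto simp: deletion_def Q_def)
  qed
  have active_con: "g \<in> ext_active (E - {e}) (contraction indep e) r B \<longleftrightarrow>
      (\<forall>x\<in>B. P g x \<longrightarrow> (g, x) \<in> r)" if "g \<in> E - insert e B" for g
    using that ext_active_contraction_iff[OF assms(1-4), of g] by (simp add: P_def)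
  have "g \<in> ext_active (E - {e}) (deletion indep e) r (insert f B) \<longleftrightarrow>
      g \<in> ext_active (E - {e}) (contraction indep e) r B" if g: "g \<in> E - insert e B" "g \<noteq> f" for g
  proof (cases "g \<in> D")
    case False
    hence dep: "\<not> indep (insert g B)"
      using g by (simp add: D_def)
    have "P g x \<longleftrightarrow> Q g x" if x: "x \<in> B" for x
    proof -
      have xB: "insert x (insert h (B - {x})) = insert h B" for h
        using x by auto
      \<comment> \<open>As \<open>x\<close> cannot be added back to
        \<open>insert g (B - {x})\<close>, augmentation must add \<open>h\<close>. Taking
        \<open>e\<close> and \<open>f\<close> for \<open>h\<close>, both \<open>P g x\<close> and
        \<open>Q g x\<close> amount to independence of \<open>insert g (B - {x})\<close>.\<close>
      have exch: "indep (insert h (insert g (B - {x})))"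
        if "indep (insert g (B - {x}))" "indep (insert h B)" "h \<notin> B" for h
        using indep_exchange_pair[of x h "B - {x}" g] that x dep unfolding xB by blast
      show ?thesis
        using exch[of e] exch[of f] eB fB assms(2) fE
          indep_subset[of "insert e (insert g (B - {x}))" "insert g (B - {x})"]
          indep_subset[of "insert g (insert f (B - {x}))" "insert g (B - {x})"]
        unfolding P_def Q_def insert_commute[of g f] by blast
    qed
    thus ?thesis
      using active_del[OF g] active_con[OF g(1)] dep by simp
  next
    case True
    \<comment> \<open>If one pair from \<open>e\<close>, \<open>f\<close>, \<open>g\<close> is
      independent over \<open>B - {x}\<close>, so is a pair containing the third element.\<close>
    have PQ: "P g x \<or> P f x" if "Q g x" for x
      using that indep_exchange_pair[of g f "B - {x}" e] sub[of x] g fE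
      by (auto simp: P_def Q_def insert_commute)
    have QP: "P f x \<or> Q g x" if "P g x" for x
      using that indep_exchange_pair[of e g "B - {x}" f] sub[of x] g fE assms(2)
      by (auto simp: P_def Q_def insert_commute)
    have gg: "(m g, g) \<in> r"
      using m(2)[OF True, of g] by (simp add: N_def)
    have "(\<forall>x\<in>B. P g x \<longrightarrow> (g, x) \<in> r) \<longleftrightarrow> (g, f) \<in> r \<and> (\<forall>x\<in>B. Q g x \<longrightarrow> (g, x) \<in> r)"
    proof
      \<comment> \<open>Here \<open>g\<close> is least in \<open>N g\<close>, so maximality of
        \<open>m f\<close> puts \<open>g\<close> below all of \<open>N f\<close>, including
        \<open>f\<close>.\<close>
      assume act: "\<forall>x\<in>B. P g x \<longrightarrow> (g, x) \<in> r"
      hence "(g, m g) \<in> r"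
        using m(1)[OF True] r(3)[of g] g(1) by (auto simp: N_def)
      hence "(g, x) \<in> r" if "x \<in> N f" for x
        using f_max[OF True] m(2)[OF f that] r(1)[OF fE(1)] by (meson transD)
      thus "(g, f) \<in> r \<and> (\<forall>x\<in>B. Q g x \<longrightarrow> (g, x) \<in> r)"
        using act PQ by (auto simp: N_def)
    next
      assume act: "(g, f) \<in> r \<and> (\<forall>x\<in>B. Q g x \<longrightarrow> (g, x) \<in> r)"
      have "m g = g"
      \<comment> \<open>Otherwise \<open>m g\<close> is not exchangeable in the sense of
        \<open>Q\<close>, so it lies in \<open>N f\<close>. This forces \<open>m g = m f\<close>,
        and then minimality of \<open>f\<close> contradicts \<open>(g, f) \<in> r\<close>.\<close>
      proof (rule ccontr)
        assume "m g \<noteq> g"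
        hence mg: "m g \<in> B" "P g (m g)"
          using m(1)[OF True] by (auto simp: N_def)
        have "(g, m g) \<notin> r"
          using gg \<open>m g \<noteq> g\<close> antisymD[OF r(2)[OF fE(1)]] by blast
        hence "P f (m g)"
          using QP[OF mg(2)] act mg(1) by auto
        hence "(m f, m g) \<in> r"
          using m(2)[OF f] mg(1) by (simp add: N_def)
        hence "m g = m f"
          using f_max[OF True] antisymD[OF r(2)[OF fE(1)]] by blast
        hence "(f, g) \<in> r"
          by (rule f_min[OF True])
        thus False
          using act g(2) antisymD[OF r(2)[OF fE(1)]] by blast
      qed
      thus "\<forall>x\<in>B. P g x \<longrightarrow> (g, x) \<in> r"
        using m(2)[OF True] by (auto simp: N_def)
    qed
    thus ?thesis
      using active_del[OF g] active_con[OF g(1)] True by (simp add: D_def)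
  qed
  \<comment> \<open>As a basis element, \<open>f\<close> is never active in the deletion, though it
    may be in the contraction.\<close>
  moreover have "ext_active (E - {e}) (deletion indep e) r (insert f B) \<subseteq> E - insert e B - {f}"
    "ext_active (E - {e}) (contraction indep e) r B \<subseteq> E - insert e B"
    by (auto simp: ext_active_def)
  ultimately have "ext_active (E - {e}) (deletion indep e) r (insert f B) =
      ext_active (E - {e}) (contraction indep e) r B - {f}"
    by blast
  thus ?thesis
    using basis fE by blast
qed

section \<open>Recursion for the two complexes\<close>

lemma ext_activity_complex_eq:
  "ext_activity_complex E indep r = (\<Union>B\<in>{B. basis indep B}. Pow (act_facet E indep r B))"
  by (auto simp: ext_activity_complex_def)

text \<open>A loop lies in no basis and is always active: its copy is in every facet, the loop
  itself in none.\<close>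

lemma ext_activity_complex_loop:
  assumes "linear_order_on A r" "E \<subseteq> A" "e \<in> E" "\<And>x. x \<in> E \<Longrightarrow> (x, e) \<in> r" "\<not> indep {e}"
  shows "ext_activity_complex E indep r =
    cone (Inr e) (ext_activity_complex (E - {e}) (deletion indep e) r)"
proof -
  interpret D: matroid "E - {e}" "deletion indep e"
    by (rule matroid_deletion)
  have notin: "e \<notin> B" if "basis indep B" for B
    using that assms(5) indep_subset[of B "{e}"] by (auto simp: basis_def)
  have bases: "{B. basis (deletion indep e) B} = {B. basis indep B}"
    using notin basis_deletion_iff indep_subset_basis[OF indep_empty] by blast
  have "act_facet E indep r B = insert (Inr e) (act_facet (E - {e}) (deletion indep e) r B)"
    if B: "basis indep B" for B
  proof -
    have eB: "e \<in> E - B" and DB: "basis (deletion indep e) B"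
      using notin[OF B] assms(3) B bases by auto
    have "e \<in> ext_active E indep r B"
      using ext_active_greatest[OF B eB assms(1,2,4)] assms(5) by simp
    thus ?thesis
      unfolding act_facet_eq[OF B] D.act_facet_eq[OF DB] ext_active_deletion[OF B eB assms(1,2)]
      by auto
  qed
  hence "ext_activity_complex E indep r = (\<Union>B\<in>{B. basis indep B}.
      Pow (insert (Inr e) (act_facet (E - {e}) (deletion indep e) r B)))"
    unfolding ext_activity_complex_eq by (intro SUP_cong) auto
  thus ?thesis
    unfolding UN_Pow_insert D.ext_activity_complex_eq bases .
qed

text \<open>For bases avoiding \<open>e\<close> it is passive and gives only \<open>Inl e\<close>;
  bases containing it give both copies. The first union runs over bases of the whole matroid, so it
  is empty for a coloop.\<close>

lemma ext_activity_complex_nonloop: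
  assumes "linear_order_on A r" "E \<subseteq> A" "e \<in> E" "\<And>x. x \<in> E \<Longrightarrow> (x, e) \<in> r" "indep {e}"
  shows "ext_activity_complex E indep r = cone (Inl e)
    ((\<Union>B\<in>{B. basis indep B \<and> e \<notin> B}. Pow (act_facet (E - {e}) (deletion indep e) r B)) \<union>
     cone (Inr e) (ext_activity_complex (E - {e}) (contraction indep e) r))"
proof -
  interpret D: matroid "E - {e}" "deletion indep e"
    by (rule matroid_deletion)
  interpret C: matroid "E - {e}" "contraction indep e"
    by (rule matroid_contraction[OF assms(5)])
  let ?fd = "act_facet (E - {e}) (deletion indep e) r"
  let ?fc = "act_facet (E - {e}) (contraction indep e) r"
  let ?\<B> = "{B. basis indep B \<and> e \<notin> B}" and ?\<C> = "{B. basis (contraction indep e) B}"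
  have "{B. basis indep B} = ?\<B> \<union> insert e ` ?\<C>"
  proof -
    have "B \<in> insert e ` ?\<C>" if "basis indep B" "e \<in> B" for B
      using that by (intro image_eqI[of _ _ "B - {e}"])
        (auto simp: basis_contraction_iff[OF assms(5)] insert_absorb)
    thus ?thesis
      by (auto simp: basis_contraction_iff[OF assms(5)])
  qed
  hence "ext_activity_complex E indep r =
      (\<Union>B\<in>?\<B>. Pow (act_facet E indep r B)) \<union> (\<Union>B\<in>?\<C>. Pow (act_facet E indep r (insert e B)))"
    unfolding ext_activity_complex_eq by simp
  also have "(\<Union>B\<in>?\<B>. Pow (act_facet E indep r B)) = (\<Union>B\<in>?\<B>. Pow (insert (Inl e) (?fd B)))"
  proof (intro SUP_cong refl arg_cong[of _ _ Pow])
    fix B assume "B \<in> ?\<B>"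
    hence B: "basis indep B" and eB: "e \<in> E - B"
      using assms(3) by auto
    have DB: "basis (deletion indep e) B"
      using basis_deletion_iff[OF B] B eB by auto
    have "e \<notin> ext_active E indep r B"
      using ext_active_greatest[OF B eB assms(1,2,4)] assms(5) by simp
    thus "act_facet E indep r B = insert (Inl e) (?fd B)"
      unfolding act_facet_eq[OF B] D.act_facet_eq[OF DB] ext_active_deletion[OF B eB assms(1,2)]
      using assms(3) by auto
  qed
  also have "\<dots> = cone (Inl e) (\<Union>B\<in>?\<B>. Pow (?fd B))"
    by (rule UN_Pow_insert)
  also have "(\<Union>B\<in>?\<C>. Pow (act_facet E indep r (insert e B))) =
      (\<Union>B\<in>?\<C>. Pow (insert (Inl e) (insert (Inr e) (?fc B))))"
  proof (intro SUP_cong refl arg_cong[of _ _ Pow])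
    fix B assume "B \<in> ?\<C>"
    hence CB: "basis (contraction indep e) B" and B: "basis indep (insert e B)" "e \<notin> B"
      using basis_contraction_iff[OF assms(5)] by auto
    have "e \<notin> ext_active E indep r (insert e B)"
      by (simp add: ext_active_def)
    moreover have "ext_active (E - {e}) (contraction indep e) r B = ext_active E indep r (insert e B)"
      using ext_active_contraction[OF B assms(1,2)] assms(4) by blast
    ultimately show "act_facet E indep r (insert e B) = insert (Inl e) (insert (Inr e) (?fc B))"
      unfolding act_facet_eq[OF B(1)] C.act_facet_eq[OF CB] using assms(3) by auto
  qed
  also have "\<dots> = cone (Inl e) (cone (Inr e) (\<Union>B\<in>?\<C>. Pow (?fc B)))"
    unfolding UN_Pow_insert ..
  also have "cone (Inl e) X \<union> cone (Inl e) Y = cone (Inl e) (X \<union> Y)" for X Y :: "('a + 'a) set set"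
    by (auto simp: cone_def)
  finally show ?thesis
    unfolding C.ext_activity_complex_eq .
qed

text \<open>With \<open>f\<close> from \<open>ext_active_contraction_deletion\<close>, the active
  set loses at most \<open>f\<close> while \<open>f\<close> joins the basis, so the facet only
  grows.\<close>

lemma ext_activity_complex_contraction_subset:
  assumes "linear_order_on A r" "E \<subseteq> A" "indep {e}" "basis indep B0" "e \<notin> B0"
  shows "ext_activity_complex (E - {e}) (contraction indep e) r \<subseteq>
    ext_activity_complex (E - {e}) (deletion indep e) r"
proof
  interpret D: matroid "E - {e}" "deletion indep e"
    by (rule matroid_deletion)
  interpret C: matroid "E - {e}" "contraction indep e"
    by (rule matroid_contraction[OF assms(3)])
  fix S assume "S \<in> ext_activity_complex (E - {e}) (contraction indep e) r"
  then obtain B where CB: "basis (contraction indep e) B"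
    and S: "S \<subseteq> act_facet (E - {e}) (contraction indep e) r B"
    by (auto simp: ext_activity_complex_def)
  have B: "basis indep (insert e B)" "e \<notin> B"
    using CB basis_contraction_iff[OF assms(3)] by auto
  obtain f where f: "f \<in> E - insert e B" "basis indep (insert f B)"
    and active: "ext_active (E - {e}) (deletion indep e) r (insert f B) =
      ext_active (E - {e}) (contraction indep e) r B - {f}"
    using ext_active_contraction_deletion[OF B assms(1,2,4,5)] by blast
  have DB: "basis (deletion indep e) (insert f B)"
    using basis_deletion_iff[OF assms(4,5)] f B(2) by auto
  have "act_facet (E - {e}) (contraction indep e) r B \<subseteq>
      act_facet (E - {e}) (deletion indep e) r (insert f B)"
    unfolding D.act_facet_eq[OF DB] C.act_facet_eq[OF CB] active by auto
  with S DB show "S \<in> ext_activity_complex (E - {e}) (deletion indep e) r"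
    by (auto simp: ext_activity_complex_def)
qed

lemma independence_complex_nonloop:
  "independence_complex indep =
    independence_complex (deletion indep e) \<union> insert e ` independence_complex (contraction indep e)"
proof -
  have "X \<in> insert e ` independence_complex (contraction indep e)" if "indep X" "e \<in> X" for X
    using that by (intro image_eqI[of _ _ "X - {e}"])
      (auto simp: independence_complex_def contraction_def insert_absorb)
  thus ?thesis
    by (auto simp: independence_complex_def contraction_def deletion_def)
qed

end

section \<open>Induction and comparison of the h-vectors\<close>

text \<open>The degrees are the facet sizes of the two complexes; \<open>B\<close> serves to express
  the rank.\<close>

lemma face_poly_ext_activity_complex:
  assumes "matroid E indep" "basis indep B" "linear_order_on A r" "E \<subseteq> A"
  shows "face_poly (ext_activity_complex E indep r) (card E + card B) =
    [:0, 1:] ^ card E * face_poly (independence_complex indep) (card B)"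
  using assms
proof (induction "card E" arbitrary: E indep B)
  case 0
  interpret matroid E indep
    by (rule "0.prems"(1))
  have E: "E = {}"
    using "0.hyps" finite_ground by simp
  have indep: "indep X \<longleftrightarrow> X = {}" for X
    using indep_subset_ground indep_empty E by auto
  have "basis indep X \<longleftrightarrow> X = {}" for X
    by (auto simp: basis_def indep)
  hence B: "B = {}" and act: "ext_activity_complex E indep r = {{}}"
    using "0.prems"(2)
    by (auto simp: ext_activity_complex_def act_facet_def ext_active_def ext_passive_def E)
  have "independence_complex indep = {{}}"
    by (simp add: independence_complex_def indep)
  thus ?case
    unfolding act by (simp add: E B face_poly_def)
next
  case (Suc n)
  interpret matroid E indep
    by (rule Suc.prems(1))
  note r = Suc.prems(3,4)
  have "\<exists>e\<in>E. \<forall>x\<in>E. (e, x) \<in> r\<inverse>"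
    using Suc.hyps(2) Suc.prems(4) finite_ground r(1)
    by (intro linear_order_on_has_least[of A]) auto
  then obtain e where e: "e \<in> E" "\<And>x. x \<in> E \<Longrightarrow> (x, e) \<in> r"
    by auto
  have n: "n = card (E - {e})" "card E = Suc n" and A: "E - {e} \<subseteq> A"
    using Suc.hyps(2) e(1) r(2) by auto
  interpret D: matroid "E - {e}" "deletion indep e"
    by (rule matroid_deletion)
  let ?Del = "ext_activity_complex (E - {e}) (deletion indep e) r"
  let ?Con = "ext_activity_complex (E - {e}) (contraction indep e) r"
  note IH = Suc.hyps(1)[OF n(1) _ _ r(1) A, folded n(1)]
  show ?case
  proof (cases "indep {e}")
    case False
    \<comment> \<open>Deleting a loop keeps the independence complex, while the activity complex
      loses one cone.\<close>
    hence "deletion indep e = indep"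
      using indep_subset[of _ "{e}"] by (intro ext) (auto simp: deletion_def)
    moreover from this have DB: "basis (deletion indep e) B"
      using Suc.prems(2) by simp
    moreover have "face_poly (cone (Inr e) ?Del) (Suc (n + card B)) =
        [:0, 1:] * face_poly ?Del (n + card B)"
      using D.finite_ext_activity_complex D.ext_activity_complex_face[OF DB, of _ r]
      by (intro face_poly_cone) (fastforce simp: n(1))+
    ultimately show ?thesis
      using ext_activity_complex_loop[OF r e False] IH[OF D.matroid_axioms DB]
      by (simp add: n(2) algebra_simps del: mult_pCons_left mult_pCons_right)
  next
    case True
    interpret C: matroid "E - {e}" "contraction indep e"
      by (rule matroid_contraction[OF True])
    obtain B1 where B1: "basis indep B1" "e \<in> B1"
      using indep_subset_basis[OF True] by auto
    define B' where "B' = B1 - {e}"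
    have CB: "basis (contraction indep e) B'"
      using B1 by (simp add: B'_def basis_contraction_iff[OF True] insert_absorb)
    have "card B = card B1" "finite B1"
      using B1(1) Suc.prems(2) basis_iff_card indep_finite by (auto simp: basis_def)
    hence B: "card B = Suc (card B')"
      using B1(2) by (simp add: B'_def card_Suc_Diff1 del: card_Diff_insert)
    have con: "finite ?Con" "\<And>S. S \<in> ?Con \<Longrightarrow>
        finite S \<and> card S \<le> n + card B' \<and> Inl e \<notin> S \<and> Inr e \<notin> S"
      using C.finite_ext_activity_complex C.ext_activity_complex_face[OF CB, of _ r]
      by (fastforce simp: n(1))+
    have icon: "finite (independence_complex (contraction indep e))"
      "\<And>S. S \<in> independence_complex (contraction indep e) \<Longrightarrow>
        finite S \<and> card S \<le> card B' \<and> e \<notin> S"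
      using C.finite_indep C.indep_finite C.indep_card_le_basis[OF CB]
      by (auto simp: independence_complex_def contraction_def)
    show ?thesis
    proof (cases "\<exists>B0. basis indep B0 \<and> e \<notin> B0")
      case False
      \<comment> \<open>Now \<open>e\<close> is a coloop: deletion and contraction agree, and the
        independence complex is a cone with apex \<open>e\<close>.\<close>
      have "indep (insert e X)" if X: "indep X" for X
      proof -
        obtain B0 where "basis indep B0" "X \<subseteq> B0"
          using indep_subset_basis[OF X] by auto
        thus ?thesis
          using False indep_subset[of B0 "insert e X"] by (auto simp: basis_def)
      qed
      hence "deletion indep e X \<longleftrightarrow> contraction indep e X" for X
        using indep_subset[of "insert e X" X] by (auto simp: deletion_def contraction_def)
      hence "independence_complex indep = cone e (independence_complex (contraction indep e))"
        using independence_complex_nonloop[of e] by (simp add: cone_def independence_complex_def)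
      hence IN: "face_poly (independence_complex indep) (card B) =
          [:0, 1:] * face_poly (independence_complex (contraction indep e)) (card B')"
        unfolding B using face_poly_cone[OF icon] by simp
      have "(\<Union>B\<in>{B. basis indep B \<and> e \<notin> B}.
          Pow (act_facet (E - {e}) (deletion indep e) r B)) = {}"
        using False by auto
      hence "ext_activity_complex E indep r = cone (Inl e) (cone (Inr e) ?Con)"
        using ext_activity_complex_nonloop[OF r e True] by (simp only: Un_empty_left)
      also have "face_poly \<dots> (Suc (Suc (n + card B'))) =
          [:0, 1:] * face_poly (cone (Inr e) ?Con) (Suc (n + card B'))"
        using con by (intro face_poly_cone) (auto simp: cone_def card_insert_if le_SucI)
      also have "face_poly (cone (Inr e) ?Con) (Suc (n + card B')) =
          [:0, 1:] * face_poly ?Con (n + card B')"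
        using con by (intro face_poly_cone) auto
      also have "face_poly ?Con (n + card B') =
          [:0, 1:] ^ n * face_poly (independence_complex (contraction indep e)) (card B')"
        by (rule IH[OF C.matroid_axioms CB])
      finally show ?thesis
        by (simp add: IN[unfolded B] B n(2) algebra_simps del: mult_pCons_left mult_pCons_right)
    next
      case True
      then obtain B0 where B0: "basis indep B0" "e \<notin> B0"
        by auto
      have DB: "basis (deletion indep e) B0" and cB0: "card B0 = Suc (card B')"
        using basis_deletion_iff[OF B0] B0 B basis_iff_card[OF B0(1)] Suc.prems(2) by auto
      have del: "finite ?Del" "\<And>S. S \<in> ?Del \<Longrightarrow>
          finite S \<and> card S \<le> Suc (n + card B') \<and> Inl e \<notin> S \<and> Inr e \<notin> S"
        using D.finite_ext_activity_complex D.ext_activity_complex_face[OF DB, of _ r]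
        by (fastforce simp: n(1) cB0)+
      have idel: "finite (independence_complex (deletion indep e))"
        "\<And>S. S \<in> independence_complex (deletion indep e) \<Longrightarrow> e \<notin> S"
        using D.finite_indep by (simp_all add: independence_complex_def deletion_def)
      have IN: "face_poly (independence_complex indep) (card B) =
          face_poly (independence_complex (deletion indep e)) (Suc (card B')) +
          face_poly (independence_complex (contraction indep e)) (card B')"
        unfolding independence_complex_nonloop[of e] B
        by (rule face_poly_Un_insert) (use icon idel in blast)+
      have "(\<Union>B\<in>{B. basis indep B \<and> e \<notin> B}.
          Pow (act_facet (E - {e}) (deletion indep e) r B)) = ?Del"
        using basis_deletion_iff[OF B0] by (simp add: D.ext_activity_complex_eq)
      hence "ext_activity_complex E indep r = cone (Inl e) (?Del \<union> cone (Inr e) ?Con)"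
        using ext_activity_complex_nonloop[OF r e \<open>indep {e}\<close>] by (simp only:)
      \<comment> \<open>Faces of the inner cone without its apex already lie in \<open>?Del\<close>,
        so \<open>?Con\<close> is counted only with \<open>Inr e\<close> inserted.\<close>
      also have "?Del \<union> cone (Inr e) ?Con = ?Del \<union> insert (Inr e) ` ?Con"
        using ext_activity_complex_contraction_subset[OF r \<open>indep {e}\<close> B0] by (auto simp: cone_def)
      also have "face_poly (cone (Inl e) \<dots>) (Suc (Suc (n + card B'))) =
          [:0, 1:] * face_poly (?Del \<union> insert (Inr e) ` ?Con) (Suc (n + card B'))"
        using con del by (intro face_poly_cone) (auto simp: card_insert_if le_SucI)
      \<comment> \<open>The union splits as in \<open>IN\<close>. Both parts acquire the power
        \<open>n\<close> by induction; the outer cone has supplied the remaining factor.\<close>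
      also have "face_poly (?Del \<union> insert (Inr e) ` ?Con) (Suc (n + card B')) =
          face_poly ?Del (Suc (n + card B')) + face_poly ?Con (n + card B')"
        by (rule face_poly_Un_insert) (use con del in blast)+
      also have "face_poly ?Del (Suc (n + card B')) =
          [:0, 1:] ^ n * face_poly (independence_complex (deletion indep e)) (Suc (card B'))"
        using IH[OF D.matroid_axioms DB] by (simp add: cB0)
      also have "face_poly ?Con (n + card B') =
          [:0, 1:] ^ n * face_poly (independence_complex (contraction indep e)) (card B')"
        by (rule IH[OF C.matroid_axioms CB])
      finally show ?thesis
        by (simp add: IN[unfolded B] B n(2) algebra_simps del: mult_pCons_left mult_pCons_right)
    qed
  qed
qed

theorem theorem1p3:
  fixes E :: "'a set" and indep :: "'a set \<Rightarrow> bool" and r :: "'a rel"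
  assumes "matroid E indep"
    and "linear_order_on E r"
  shows "h_vector (ext_activity_complex E indep r) = h_vector (independence_complex indep)"
proof
  interpret matroid E indep
    by (rule assms(1))
  fix i
  let ?A = "ext_activity_complex E indep r" and ?I = "independence_complex indep"
  obtain B where B: "basis indep B"
    using indep_subset_basis[OF indep_empty] by auto
  note d = max_face_size_ext_activity_complex[OF B] max_face_size_independence_complex[OF B]
  have "f_poly ?A = [:0, 1:] ^ card E * f_poly ?I"
    using face_poly_ext_activity_complex[OF assms(1) B assms(2) order_refl]
      finite_ext_activity_complex finite_indep[folded independence_complex_def]
    by (simp add: f_poly_eq_face_poly d)
  also have "[:0, 1 :: int:] ^ card E = monom 1 (card E)"
    by (simp add: monom_altdef)
  \<comment> \<open>The shift by \<open>card E\<close> equals the difference of the maximal face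
    sizes, so equal indices \<open>i\<close> correspond. For \<open>i\<close> beyond the rank, the
    coefficient read off has index below \<open>card E\<close> and vanishes, which matches the
    extension by zeros.\<close>
  finally have "coeff (f_poly ?A) j = (if j < card E then 0 else coeff (f_poly ?I) (j - card E))" for j
    by (simp add: coeff_monom_mult)
  thus "h_vector ?A i = h_vector ?I i"
    by (auto simp: h_vector_def d)
qed

end
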